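(* For every positive integer $n$, the sum $\mathrm{hsp}(n)$ of the heights of symmetric peaks over all compositions of $n$ is given by $$\mathrm{hsp}(n)=\left(\frac{7n-24}{49}\right)2^{n-1}+\frac{(-33-15i\sqrt{3})(-2)^n}{441(1+i\sqrt{3})^{n+1}}+\frac{(-33+15i\sqrt{3})(-2)^n}{441(1-i\sqrt{3})^{n+1}}+\frac{1}{3},$$ where $i=\sqrt{-1}$.
   Context: A composition of a positive integer $n$ with $k$ parts is a sequence $\pi=\pi_1\pi_2\cdots\pi_k$ of positive integers with $\sum_{j=1}^k\pi_j=n$. A symmetric peak of $\pi$ is a triple of consecutive parts $\pi_j\pi_{j+1}\pi_{j+2}$ ($1\le j\le k-2$) with $\pi_j<\pi_{j+1}$ and $\pi_j=\pi_{j+2}$; its height is $\pi_{j+1}-\pi_j$. $\mathrm{hsp}(n)$ is the sum, over all compositions $\pi$ of $n$ (with any number of parts) and all symmetric peaks of $\pi$ (one for each such position $j$), of the heights of these symmetric peaks. *)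

theory Defs
  imports Complex_Main
begin

definition compositions :: "nat \<Rightarrow> nat list set" where
  "compositions n = {p. (\<forall>x \<in> set p. 0 < x) \<and> sum_list p = n}"

text \<open>Positions are counted from 0, as for list indexing.\<close>

definition symmetric_peaks :: "nat list \<Rightarrow> nat set" where
  "symmetric_peaks p = {j. j + 2 < length p \<and> p ! j < p ! (j + 1) \<and> p ! j = p ! (j + 2)}"

text \<open>The subtraction on natural numbers does not truncate at a symmetric peak.\<close>

definition peak_height :: "nat list \<Rightarrow> nat \<Rightarrow> nat" where
  "peak_height p j = p ! (j + 1) - p ! j"

definition hsp :: "nat \<Rightarrow> nat" where
  "hsp n = (\<Sum>p \<in> compositions n. \<Sum>j \<in> symmetric_peaks p. peak_height p j)"

text \<open>Both index sets of \<^const>\<open>hsp\<close> are finite, so the sums have their usual meaning.\<close>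

lemma finite_compositions: "finite (compositions n)"
proof (rule finite_subset)
  have len: "length p \<le> sum_list p" if "\<forall>x \<in> set p. 0 < x" for p :: "nat list"
    using that by (induction p) auto
  show "compositions n \<subseteq> {p. set p \<subseteq> {..n} \<and> length p \<le> n}"
    using len member_le_sum_list by (fastforce simp: compositions_def)
  show "finite {p. set p \<subseteq> {..n} \<and> length p \<le> n}"
    by (rule finite_lists_length_le) simp
qed

lemma finite_symmetric_peaks: "finite (symmetric_peaks p)"
  by (rule finite_subset[of _ "{..<length p}"]) (auto simp: symmetric_peaks_def)

end

theory Submission
  imports Defs
begin

text \<open>
  A symmetric peak is a composition \<open>u @ [a, a + h, a] @ v\<close> with \<open>h > 0\<close>, cut at the peak, and
  \<open>hsp n\<close> adds up the heights \<open>h\<close> over all such cuts. Adding 1 to the three parts of the peak keeps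
  \<open>h\<close> and turns \<open>n\<close> into \<open>n + 3\<close>; the cuts of size \<open>n + 3\<close> missed in this way are those with
  \<open>a = 1\<close>. Replacing \<open>[1, 1 + h, 1]\<close> by \<open>[h]\<close> turns these into the compositions of \<open>n\<close> with one
  marked part \<open>h\<close>. The marked parts of one composition of \<open>n\<close> add up to \<open>n\<close>, and there are
  \<open>2 ^ (n - 1)\<close> compositions of \<open>n > 0\<close>, so
  \<open>hsp (n + 3) = hsp n + n * 2 ^ (n - 1)\<close> (lemma \<open>hsp_add_3\<close>).

  The closed form solves this recurrence: \<open>(7 * n - 24) / 49 * 2 ^ (n - 1)\<close> is a particular
  solution, and the difference from it has period 3 in \<open>n\<close>, so it is a combination of the powers of
  the three cube roots of unity. The two fractions of the formula are the ones that belong to the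
  primitive cube roots of unity, because \<open>- 2 / (1 + \<i> * sqrt 3)\<close> is such a root.
\<close>

section \<open>Compositions cut at a part or at a symmetric peak\<close>

definition marked_compositions :: "nat \<Rightarrow> (nat list \<times> nat \<times> nat list) set" where
  "marked_compositions n = {(u, h, v). u @ [h] @ v \<in> compositions n}"

text \<open>
  Storing the height \<open>h\<close> in place of the middle part \<open>a + h\<close> makes the weight a coordinate that
  the shift of \<open>a\<close> does not touch.
\<close>

definition peaked_compositions :: "nat \<Rightarrow> (nat list \<times> nat \<times> nat \<times> nat list) set" where
  "peaked_compositions n = {(u, a, h, v). 0 < h \<and> u @ [a, a + h, a] @ v \<in> compositions n}"

lemma append_three_nth_drop:
  assumes "j + 2 < length p"
  shows "take j p @ [p ! j, p ! (j + 1), p ! (j + 2)] @ drop (j + 3) p = p"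
proof -
  have "drop j p = p ! j # p ! (j + 1) # p ! (j + 2) # drop (j + 3) p"
    using assms by (simp add: Cons_nth_drop_Suc numeral_2_eq_2 numeral_3_eq_3)
  then show ?thesis
    by (metis append_take_drop_id append_Cons append_Nil)
qed

lemma bij_betw_peaked_compositions:
  "bij_betw (\<lambda>(u, a, h, v). (u @ [a, a + h, a] @ v, length u)) (peaked_compositions n)
     (Sigma (compositions n) symmetric_peaks)"
proof (rule bij_betw_byWitness)
  let ?f = "\<lambda>(u, a, h, v). (u @ [a, a + h, a] @ v, length u)"
  let ?g = "\<lambda>(p, j). (take j p, p ! j, peak_height p j, drop (j + 3) p)"
  show "\<forall>c \<in> peaked_compositions n. ?g (?f c) = c"
    by (auto simp: peak_height_def nth_append)
  have inv: "?f (?g (p, j)) = (p, j)" if "j \<in> symmetric_peaks p" for p j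
    using that append_three_nth_drop[of j p]
    by (auto simp: symmetric_peaks_def peak_height_def)
  then show "\<forall>c \<in> Sigma (compositions n) symmetric_peaks. ?f (?g c) = c"
    by fastforce
  show "?f ` peaked_compositions n \<subseteq> Sigma (compositions n) symmetric_peaks"
    by (auto simp: peaked_compositions_def symmetric_peaks_def nth_append)
  show "?g ` Sigma (compositions n) symmetric_peaks \<subseteq> peaked_compositions n"
    using inv by (fastforce simp: peaked_compositions_def symmetric_peaks_def peak_height_def)
qed

lemma finite_peaked_compositions: "finite (peaked_compositions n)"
  using bij_betw_finite[OF bij_betw_peaked_compositions] finite_compositions finite_symmetric_peaks
  by blast

lemma hsp_eq_sum_peaked_compositions:
  "hsp n = (\<Sum>(u, a, h, v) \<in> peaked_compositions n. h)"
proof -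
  have "hsp n = (\<Sum>(p, j) \<in> Sigma (compositions n) symmetric_peaks. peak_height p j)"
    unfolding hsp_def
    by (rule sum.Sigma) (simp_all add: finite_compositions finite_symmetric_peaks)
  also have "\<dots> = (\<Sum>c \<in> peaked_compositions n.
      case (case c of (u, a, h, v) \<Rightarrow> (u @ [a, a + h, a] @ v, length u)) of (p, j) \<Rightarrow> peak_height p j)"
    by (rule sum.reindex_bij_betw[OF bij_betw_peaked_compositions, symmetric])
  also have "\<dots> = (\<Sum>(u, a, h, v) \<in> peaked_compositions n. h)"
    by (rule sum.cong) (auto simp: peak_height_def nth_append)
  finally show ?thesis .
qed

lemma bij_betw_marked_compositions:
  "bij_betw (\<lambda>(u, h, v). (u @ [h] @ v, length u)) (marked_compositions n)
     (SIGMA p:compositions n. {..<length p})"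
  by (rule bij_betw_byWitness[where f' = "\<lambda>(p, j). (take j p, p ! j, drop (Suc j) p)"])
    (auto simp: marked_compositions_def id_take_nth_drop[symmetric])

lemma finite_marked_compositions: "finite (marked_compositions n)"
  using bij_betw_finite[OF bij_betw_marked_compositions] finite_compositions by blast

lemma sum_marked_compositions:
  "(\<Sum>(u, h, v) \<in> marked_compositions n. h) = n * card (compositions n)"
proof -
  have "(\<Sum>(u, h, v) \<in> marked_compositions n. h) = (\<Sum>c \<in> marked_compositions n.
      case (case c of (u, h, v) \<Rightarrow> (u @ [h] @ v, length u)) of (p, j) \<Rightarrow> p ! j)"
    by (rule sum.cong) auto
  also have "\<dots> = (\<Sum>(p, j) \<in> (SIGMA p:compositions n. {..<length p}). p ! j)"
    by (rule sum.reindex_bij_betw[OF bij_betw_marked_compositions])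
  also have "\<dots> = (\<Sum>p \<in> compositions n. \<Sum>j<length p. p ! j)"
    by (rule sum.Sigma[symmetric]) (simp_all add: finite_compositions)
  also have "\<dots> = (\<Sum>p \<in> compositions n. n)"
    by (rule sum.cong) (auto simp: compositions_def sum_list_sum_nth atLeast0LessThan)
  finally show ?thesis by (simp add: mult.commute)
qed

section \<open>The recurrence\<close>

text \<open>
  Either \<open>a \<ge> 2\<close>, and the three parts of the peak can be lowered by 1, or \<open>a = 1\<close>, and
  \<open>[1, 1 + h, 1]\<close> can be contracted to \<open>[h]\<close>; both remove 3 from the sum.
\<close>

lemma peaked_compositions_add_3:
  "peaked_compositions (n + 3) =
     (\<lambda>(u, a, h, v). (u, Suc a, h, v)) ` peaked_compositions n \<union>
     (\<lambda>(u, h, v). (u, 1, h, v)) ` marked_compositions n" (is "_ = ?S ` _ \<union> ?I ` _")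
proof (intro subset_antisym subsetI)
  fix c assume c: "c \<in> peaked_compositions (n + 3)"
  obtain u a h v where [simp]: "c = (u, a, h, v)" by (cases c)
  show "c \<in> ?S ` peaked_compositions n \<union> ?I ` marked_compositions n"
  proof (cases "a = 1")
    case True
    then have "(u, h, v) \<in> marked_compositions n"
      using c by (auto simp: peaked_compositions_def marked_compositions_def compositions_def)
    then show ?thesis using True by force
  next
    case False
    then have "(u, a - 1, h, v) \<in> peaked_compositions n" "Suc (a - 1) = a"
      using c by (auto simp: peaked_compositions_def compositions_def)
    then show ?thesis by force
  qed
next
  fix c assume "c \<in> ?S ` peaked_compositions n \<union> ?I ` marked_compositions n"
  then show "c \<in> peaked_compositions (n + 3)"
    by (auto simp: peaked_compositions_def marked_compositions_def compositions_def)
qed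

lemma hsp_add_3: "hsp (n + 3) = hsp n + n * card (compositions n)"
proof -
  let ?S = "\<lambda>(u, a, h, v). (u, Suc a, h, v)" and ?I = "\<lambda>(u, h, v). (u, 1 :: nat, h, v)"
  let ?h = "\<lambda>(u, a, h, v). h :: nat"
  have "hsp (n + 3) = sum ?h (?S ` peaked_compositions n \<union> ?I ` marked_compositions n)"
    by (simp only: hsp_eq_sum_peaked_compositions peaked_compositions_add_3)
  also have "\<dots> = sum ?h (?S ` peaked_compositions n) + sum ?h (?I ` marked_compositions n)"
  proof (rule sum.union_disjoint)
    show "?S ` peaked_compositions n \<inter> ?I ` marked_compositions n = {}"
      by (auto simp: peaked_compositions_def compositions_def)
  qed (simp_all add: finite_peaked_compositions finite_marked_compositions)
  also have "sum ?h (?S ` peaked_compositions n) = hsp n"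
    by (subst sum.reindex)
      (auto simp: inj_on_def hsp_eq_sum_peaked_compositions intro!: sum.cong)
  also have "sum ?h (?I ` marked_compositions n) = (\<Sum>(u, h, v) \<in> marked_compositions n. h)"
    by (subst sum.reindex) (auto simp: inj_on_def intro!: sum.cong)
  also have "\<dots> = n * card (compositions n)"
    by (rule sum_marked_compositions)
  finally show ?thesis .
qed

text \<open>The smallest composition with a symmetric peak is \<open>[1, 2, 1]\<close>.\<close>

lemma hsp_eq_0:
  assumes "n < 4"
  shows "hsp n = 0"
proof -
  have "peaked_compositions n = {}"
    using assms by (auto simp: peaked_compositions_def compositions_def)
  then show ?thesis by (simp add: hsp_eq_sum_peaked_compositions)
qed

text \<open>
  A composition of \<open>n + 1\<close> starts with 1, which can be deleted, or with a larger part, which can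
  be lowered by 1. For \<open>n = 0\<close> the second case does not occur, since \<open>[]\<close> has no first part.
\<close>

lemma compositions_Suc:
  assumes "0 < n"
  shows "compositions (Suc n) =
    (#) 1 ` compositions n \<union> (\<lambda>p. Suc (hd p) # tl p) ` compositions n"
    (is "_ = ?A ` _ \<union> ?B ` _")
proof (intro subset_antisym subsetI)
  fix p assume p: "p \<in> compositions (Suc n)"
  then obtain a q where [simp]: "p = a # q" by (cases p) (auto simp: compositions_def)
  show "p \<in> ?A ` compositions n \<union> ?B ` compositions n"
  proof (cases "a = 1")
    case True
    then show ?thesis using p by (auto simp: compositions_def)
  next
    case False
    then have "(a - 1) # q \<in> compositions n" "p = ?B ((a - 1) # q)"
      using p by (auto simp: compositions_def)
    then show ?thesis by blast
  qed
next
  fix p assume "p \<in> ?A ` compositions n \<union> ?B ` compositions n"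
  moreover have "?B q \<in> compositions (Suc n)" if "q \<in> compositions n" for q
    using that assms by (cases q) (auto simp: compositions_def)
  ultimately show "p \<in> compositions (Suc n)"
    by (auto simp: compositions_def)
qed

lemma card_compositions: "card (compositions (Suc n)) = 2 ^ n"
proof (induction n)
  case 0
  have "compositions (Suc 0) = {[1]}"
  proof (intro subset_antisym subsetI)
    fix p assume p: "p \<in> compositions (Suc 0)"
    then obtain a q where "p = a # q" by (cases p) (auto simp: compositions_def)
    with p show "p \<in> {[1]}" by (cases q) (auto simp: compositions_def)
  qed (simp add: compositions_def)
  then show ?case by simp
next
  case (Suc n)
  let ?C = "compositions (Suc n)" and ?B = "\<lambda>p. Suc (hd p) # tl p"
  have ne: "p \<noteq> []" "0 < hd p" if "p \<in> ?C" for p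
    using that by (cases p; auto simp: compositions_def)+
  have "card (compositions (Suc (Suc n))) = card ((#) 1 ` ?C \<union> ?B ` ?C)"
    by (simp only: compositions_Suc[OF zero_less_Suc])
  also have "\<dots> = card ((#) 1 ` ?C) + card (?B ` ?C)"
  proof (rule card_Un_disjoint)
    show "(#) 1 ` ?C \<inter> ?B ` ?C = {}" using ne(2) by force
  qed (simp_all add: finite_compositions)
  also have "card ((#) 1 ` ?C) = card ?C"
    by (rule card_image) simp
  also have "card (?B ` ?C) = card ?C"
    by (rule card_image, rule inj_onI) (metis ne(1) list.inject list.collapse nat.inject)
  finally show ?case by (simp add: Suc.IH)
qed

section \<open>Solving the recurrence\<close>

text \<open>
  With \<open>s = \<plusminus>\<i> * sqrt 3\<close> this brings the fractions of the closed form into the shape of a constant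
  times a power of a primitive cube root of unity.
\<close>

lemma fraction_eq_root_of_unity_power:
  fixes s :: complex
  assumes s: "s ^ 2 = - 3"
  shows "((- 33 - 15 * s) * (- 2) ^ n) / (441 * (1 + s) ^ (n + 1)) =
    (3 * s - 13) / 294 * ((s - 1) / 2) ^ n"
proof -
  have ss: "s * s = - 3" using s by (simp add: power2_eq_square)
  then have prod: "(1 + s) * (1 - s) = 4" by (simp add: algebra_simps)
  then have nz: "1 + s \<noteq> 0" by auto
  have root: "- 2 / (1 + s) = (s - 1) / 2"
    using nz prod by (simp add: field_simps)
  have const: "(- 33 - 15 * s) / (441 * (1 + s)) = (3 * s - 13) / 294"
  proof (subst frac_eq_eq)
    show "(- 33 - 15 * s) * 294 = (3 * s - 13) * (441 * (1 + s))"
      using ss by (simp add: algebra_simps)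
  qed (simp_all add: nz del: distrib_left_numeral)
  have "((- 33 - 15 * s) * (- 2) ^ n) / (441 * (1 + s) ^ (n + 1)) =
      (- 33 - 15 * s) / (441 * (1 + s)) * (- 2 / (1 + s)) ^ n"
    by (simp only: power_divide power_add power_one_right times_divide_times_eq mult_ac)
  then show ?thesis by (simp only: root const)
qed

text \<open>
  Writing \<open>2 ^ n / 98\<close> for \<open>2 ^ (n - 1) / 49\<close> makes the formula true for \<open>n = 0\<close> as well, so that
  the induction can start from 0, 1 and 2.
\<close>

lemma hsp_closed_form:
  fixes s :: complex
  assumes s: "s ^ 2 = - 3"
  shows "of_nat (hsp n) = (7 * of_nat n - 24) / 98 * 2 ^ n
    + (3 * s - 13) / 294 * ((s - 1) / 2) ^ n
    + (- 3 * s - 13) / 294 * ((- s - 1) / 2) ^ n + 1 / 3"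
proof (induction n rule: less_induct)
  case (less n)
  have ss: "s * s = - 3" using s by (simp add: power2_eq_square)
  have cube: "((t - 1) / 2) ^ 3 = 1" if "t * t = - 3" for t :: complex
  proof -
    have "(t - 1) ^ 3 = t * t * t - 3 * (t * t) + 3 * t - 1"
      by (simp add: power3_eq_cube algebra_simps)
    then show ?thesis by (simp add: that power_divide)
  qed
  consider "n = 0" | "n = 1" | "n = 2" | m where "n = m + 3"
    by (metis One_nat_def Suc_1 add.commute le_Suc_ex less_2_cases not_less_less_Suc_eq
        numeral_3_eq_3 linorder_not_less)
  then show ?case
  proof cases
    case 1
    then show ?thesis by (simp add: hsp_eq_0 field_simps)
  next
    case 2
    then show ?thesis using ss by (simp add: hsp_eq_0 field_simps)
  next
    case 3
    then show ?thesis using ss by (simp add: hsp_eq_0 field_simps power2_eq_square)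
  next
    case (4 m)
    have growth: "2 * (of_nat (m * card (compositions m)) :: complex) = of_nat m * 2 ^ m"
      by (cases m) (simp_all add: card_compositions algebra_simps)
    have "of_nat (hsp n) = of_nat (hsp m) + (of_nat (m * card (compositions m)) :: complex)"
      by (simp only: 4 hsp_add_3 of_nat_add)
    also have "\<dots> = of_nat (hsp m) + of_nat m * 2 ^ m / 2"
      using growth by (simp add: field_simps)
    also have "\<dots> = (7 * of_nat n - 24) / 98 * 2 ^ n
        + (3 * s - 13) / 294 * ((s - 1) / 2) ^ m
        + (- 3 * s - 13) / 294 * ((- s - 1) / 2) ^ m + 1 / 3"
      using 4 by (simp add: less.IH power_add field_simps)
    finally show ?thesis
      using cube[of s] cube[of "- s"] ss by (simp add: 4 power_add)
  qed
qed

theorem corollary3: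
  fixes n :: nat
  assumes "0 < n"
  shows "(of_nat (hsp n) :: complex) =
    ((7 * of_nat n - 24) / 49) * 2 ^ (n - 1)
    + ((- 33 - 15 * \<i> * complex_of_real (sqrt 3)) * (- 2) ^ n)
        / (441 * (1 + \<i> * complex_of_real (sqrt 3)) ^ (n + 1))
    + ((- 33 + 15 * \<i> * complex_of_real (sqrt 3)) * (- 2) ^ n)
        / (441 * (1 - \<i> * complex_of_real (sqrt 3)) ^ (n + 1))
    + 1 / 3"
proof -
  define s where "s = \<i> * complex_of_real (sqrt 3)"
  have s: "s ^ 2 = - 3"
    by (simp add: s_def power_mult_distrib flip: of_real_power)
  then have s': "(- s) ^ 2 = - 3" by simp
  have two: "2 ^ n = (2 :: complex) * 2 ^ (n - 1)"
    using assms by (simp flip: power_Suc)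
  have conj: "((- 33 + 15 * s) * (- 2) ^ n) / (441 * (1 - s) ^ (n + 1)) =
      (- 3 * s - 13) / 294 * ((- s - 1) / 2) ^ n"
    using fraction_eq_root_of_unity_power[OF s', of n] by simp
  have "of_nat (hsp n) = (7 * of_nat n - 24) / 49 * 2 ^ (n - 1)
      + ((- 33 - 15 * s) * (- 2) ^ n) / (441 * (1 + s) ^ (n + 1))
      + ((- 33 + 15 * s) * (- 2) ^ n) / (441 * (1 - s) ^ (n + 1)) + 1 / 3"
    unfolding fraction_eq_root_of_unity_power[OF s] conj hsp_closed_form[OF s] two by simp
  then show ?thesis by (simp add: s_def mult.assoc)
qed

end
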